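(* Let $m=m(n)$ and $k=k(n)$ be positive integer sequences with $n\ll m\ll n^2/\log^2 n$ and $k\ll\sqrt{m/n}$. For each $n$, let $\boldsymbol{\sigma}_{n,m}$ be a permutation chosen uniformly at random from the set of permutations of $[n]$ with exactly $m$ inversions. Then, for any sequence of permutations $(\tau_n)$ with $|\tau_n|=k$ and any sequence of positive integers $(j_n)$ with $j_n\leq n+1-k$, \[\mathbb{P}\big(\text{$\tau_n$ occurs at position $j_n$ in $\boldsymbol{\sigma}_{n,m}$}\big)\sim\frac{1}{k!}.\]
   Context: A permutation $\sigma$ of length $n$ is a linear ordering $\sigma(1)\ldots\sigma(n)$ of $[n]=\{1,\dots,n\}$; $|\sigma|$ denotes its length. An inversion of $\sigma$ is a pair $i<j$ with $\sigma(i)>\sigma(j)$. For sequences, $f(n)\ll g(n)$ means $f(n)/g(n)\to0$ as $n\to\infty$, and $f\sim g$ means $f(n)/g(n)\to1$. A pattern $\tau$ of length $k$ occurs at position $j$ in $\sigma$ if the sequence $\sigma(j)\sigma(j+1)\ldots\sigma(j+k-1)$ has its entries in the same relative order as $\tau(1)\ldots\tau(k)$. *)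

theory Defs
  imports
    "HOL-Combinatorics.Permutations"
    "HOL-Library.Landau_Symbols"
    "HOL-Probability.Probability"
begin

text \<open>
  A permutation of length \<open>n\<close> is a function \<open>\<sigma>\<close> with \<open>\<sigma> permutes {1..n}\<close>; positions and
  values are counted from 1. Since such a function does not determine its length, the length
  is passed as a separate argument.
\<close>

definition inversions :: "nat \<Rightarrow> (nat \<Rightarrow> nat) \<Rightarrow> (nat \<times> nat) set" where
  "inversions n \<sigma> = {(i, j). i \<in> {1..n} \<and> j \<in> {1..n} \<and> i < j \<and> \<sigma> i > \<sigma> j}"

definition perms_with_inversions :: "nat \<Rightarrow> nat \<Rightarrow> (nat \<Rightarrow> nat) set" where
  "perms_with_inversions n m = {\<sigma>. \<sigma> permutes {1..n} \<and> card (inversions n \<sigma>) = m}"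

definition occurs_at :: "nat \<Rightarrow> (nat \<Rightarrow> nat) \<Rightarrow> nat \<Rightarrow> nat \<Rightarrow> (nat \<Rightarrow> nat) \<Rightarrow> bool" where
  "occurs_at k \<tau> j n \<sigma> \<longleftrightarrow>
     1 \<le> j \<and> j + k \<le> n + 1 \<and>
     (\<forall>a\<in>{1..k}. \<forall>b\<in>{1..k}. \<sigma> (j + a - 1) < \<sigma> (j + b - 1) \<longleftrightarrow> \<tau> a < \<tau> b)"

end

theory Submission
  imports
    Defs
    "HOL-Computational_Algebra.Polynomial"
begin

text \<open>
  Sorting the entries of \<open>\<sigma>\<close> in the block of positions \<open>j, \<dots>, j + k - 1\<close> writes \<open>\<sigma>\<close> uniquely as
  \<open>\<sigma>' \<circ> \<rho>\<close>, where \<open>\<sigma>'\<close> increases on the block, \<open>\<rho>\<close> permutes the block, and inversion numbers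
  add. Hence the number of \<open>\<sigma>\<close> with \<open>m\<close> inversions and pattern \<open>\<tau>\<close> in the block is \<open>f (m - inv \<tau>)\<close>,
  where \<open>f\<close> is the coefficient sequence of \<open>[k+1]\<^sub>q \<cdots> [n]\<^sub>q\<close>, and the theorem reduces to
  \<open>f (m - t) \<sim> f m\<close> uniformly for \<open>t \<le> k\<^sup>2\<close>.

  The sequence \<open>f\<close> is symmetric and log-concave, hence increasing up to half the degree. Counting
  pairs of a sequence \<open>(e\<^sub>i)\<close> with sum \<open>s\<close> and a way to lower one entry gives
  \<open>s f(s) \<le> n (f(0) + \<dots> + f(s-1))\<close>, while log-concavity bounds the sum on the right by a geometric
  series of ratio \<open>f(s-1)/f(s)\<close>. Together they give \<open>s (f(s) - f(s-1)) \<le> n f(s-1)\<close>, so that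
  \<open>f(m) - f(m-t) = O(t n / m) f(m)\<close>, and \<open>k\<^sup>2 n / m\<close> tends to \<open>0\<close>.
\<close>

subsection \<open>Log-concave sequences\<close>

text \<open>Convolution with the indicator of \<open>{0..<i}\<close>, the effect on coefficients of
  multiplying by \<open>1 + q + ... + q^(i-1)\<close>.\<close>

definition window :: "nat \<Rightarrow> (int \<Rightarrow> int) \<Rightarrow> int \<Rightarrow> int" where
  "window i f x = (\<Sum>d<i. f (x - int d))"

text \<open>Asking for all \<open>a \<le> b\<close> rather than only \<open>a = b\<close> rules out internal zeros, and makes the
  property stable under convolution.\<close>

definition log_concave :: "(int \<Rightarrow> int) \<Rightarrow> bool" where
  "log_concave f \<longleftrightarrow> (\<forall>x. 0 \<le> f x) \<and> (\<forall>a b. a \<le> b \<longrightarrow> f (a - 1) * f (b + 1) \<le> f a * f b)"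

text \<open>Each induction step moves both end points inward by one, keeping their sum; after
  \<open>c\<close> steps they are \<open>x + c\<close> and \<open>x + d\<close>.\<close>

lemma log_concave_spread_nat:
  assumes "log_concave f" "c \<le> d"
  shows "f x * f (x + int c + int d) \<le> f (x + int c) * f (x + int d)"
  using assms(2)
proof (induction c arbitrary: x d)
  case 0
  then show ?case by simp
next
  case (Suc c)
  obtain d' where d': "d = Suc d'" "c \<le> d'" using Suc.prems by (cases d) auto
  have "f x * f (x + int (Suc c) + int d) \<le> f (x + 1) * f (x + int c + int d)"
  proof -
    have "x + 1 \<le> x + int c + int d" using Suc.prems by simp
    then have "f ((x + 1) - 1) * f ((x + int c + int d) + 1) \<le> f (x + 1) * f (x + int c + int d)"
      using assms(1) unfolding log_concave_def by blast
    then show ?thesis by (simp add: algebra_simps)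
  qed
  also have "\<dots> = f (x + 1) * f ((x + 1) + int c + int d')" by (simp add: d' algebra_simps)
  also have "\<dots> \<le> f (x + 1 + int c) * f (x + 1 + int d')" by (rule Suc.IH) (rule d')
  finally show ?case by (simp add: d' algebra_simps)
qed

lemma log_concave_spread:
  assumes "log_concave f" "x \<le> u" "x \<le> v" "x + y = u + v"
  shows "f x * f y \<le> f u * f v"
proof -
  define c d where "c = nat (u - x)" and "d = nat (v - x)"
  have eqs: "u = x + int c" "v = x + int d" "y = x + int c + int d"
    using assms by (auto simp: c_def d_def)
  show ?thesis
  proof (cases "c \<le> d")
    case True
    then show ?thesis using log_concave_spread_nat[OF assms(1) True, of x] by (simp add: eqs)
  next
    case False
    then have "d \<le> c" by simp
    from log_concave_spread_nat[OF assms(1) this, of x] show ?thesis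
      by (simp add: eqs algebra_simps)
  qed
qed

lemma window_reverse: "window i f x = (\<Sum>d<i. f (x + 1 - int i + int d))"
proof -
  have "window i f x = (\<Sum>d<i. f (x - int (i - Suc d)))"
    unfolding window_def by (rule sum.nat_diff_reindex[symmetric])
  also have "\<dots> = (\<Sum>d<i. f (x + 1 - int i + int d))"
    by (rule sum.cong) (auto simp: algebra_simps of_nat_diff)
  finally show ?thesis .
qed

lemma window_step: "window i f (x + 1) = window i f x + f (x + 1) - f (x + 1 - int i)"
  unfolding window_def by (induction i) (simp_all add: algebra_simps)

text \<open>A unit step gives a window one new term and drops one old term. The difference of the
  two products thus splits into two parts, each nonnegative by a termwise use of
  \<open>log_concave_spread\<close>.\<close>

lemma log_concave_window:
  assumes f: "log_concave f"
  shows "log_concave (window i f)"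
proof -
  have nonneg: "0 \<le> f x" for x using f by (simp add: log_concave_def)
  have "window i f (a - 1) * window i f (b + 1) \<le> window i f a * window i f b"
    if ab: "a \<le> b" for a b
  proof -
    have 1: "window i f (a - 1) * f (b + 1) \<le> f a * window i f b"
      unfolding window_def sum_distrib_left sum_distrib_right
      by (rule sum_mono, rule log_concave_spread[OF f]) (use ab in auto)
    \<comment> \<open>Here the terms must be indexed from the lower ends of the windows for paired
      factors to have equal argument sums.\<close>
    have 2: "f (a - int i) * window i f b \<le> window i f (a - 1) * f (b + 1 - int i)"
      unfolding window_reverse sum_distrib_left sum_distrib_right
      by (rule sum_mono, rule log_concave_spread[OF f]) (use ab in auto)
    have "window i f a = window i f (a - 1) + f a - f (a - int i)"
      using window_step[of i f "a - 1"] by simp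
    moreover note window_step[of i f b]
    ultimately have "window i f a * window i f b - window i f (a - 1) * window i f (b + 1)
       = (f a * window i f b - window i f (a - 1) * f (b + 1))
         + (window i f (a - 1) * f (b + 1 - int i) - f (a - int i) * window i f b)"
      by (simp only:) (simp add: algebra_simps)
    with 1 2 show ?thesis by linarith
  qed
  then show ?thesis using nonneg
    by (auto simp: log_concave_def window_def sum_nonneg)
qed

text \<open>By symmetry, log-concavity at the pair \<open>x\<close>, \<open>D - x\<close> compares
  the squares of \<open>f (x - 1)\<close> and \<open>f x\<close>.\<close>

lemma log_concave_symmetric_mono:
  assumes f: "log_concave f" and sym: "\<And>x. f (D - x) = f x" and "2 * x \<le> D"
  shows "f (x - 1) \<le> f x"
proof -
  have "f (x - 1) * f (D - x + 1) \<le> f x * f (D - x)"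
    using f assms(3) by (simp add: log_concave_def)
  moreover have "f (D - x + 1) = f (x - 1)" using sym[of "x - 1"] by (simp add: algebra_simps)
  ultimately have "(f (x - 1))\<^sup>2 \<le> (f x)\<^sup>2" by (simp add: sym power2_eq_square)
  moreover have "0 \<le> f x" using f by (simp add: log_concave_def)
  ultimately show ?thesis by (rule power2_le_imp_le)
qed

section \<open>Moment inequality and bound on increments\<close>

text \<open>Write \<open>x = (x - d) + d\<close>, where \<open>d\<close> is the newly added entry.
  The first summand is handled by \<open>moment\<close>; the second counts the ways to lower
  \<open>d\<close> and costs one more copy of the sum.\<close>

lemma window_moment_le:
  assumes nonneg: "\<And>x. 0 \<le> f x" and neg: "\<And>x. x < 0 \<Longrightarrow> f x = 0"
    and moment: "\<And>x. x * f x \<le> p * (\<Sum>y\<in>{0..<x}. f y)"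
  shows "x * window i f x \<le> (p + 1) * (\<Sum>y\<in>{0..<x}. window i f y)"
proof -
  define S where "S x = (\<Sum>y\<in>{0..<x}. f y)" for x
  have shift: "(\<Sum>y\<in>{0..<x}. f (y - int d)) = S (x - int d)" for d
  proof -
    have "(\<Sum>y\<in>{0..<x}. f (y - int d)) = (\<Sum>y\<in>{- int d..<x - int d}. f y)"
      by (rule sum.reindex_bij_witness[of _ "\<lambda>y. y + int d" "\<lambda>y. y - int d"]) auto
    also have "\<dots> = S (x - int d)"
      unfolding S_def by (rule sum.mono_neutral_right) (auto intro!: neg)
    finally show ?thesis .
  qed
  have total: "(\<Sum>y\<in>{0..<x}. window i f y) = (\<Sum>d<i. S (x - int d))"
    unfolding window_def by (subst sum.swap) (simp add: shift)
  \<comment> \<open>The factor \<open>u\<close> counts the \<open>d < u\<close>. After the exchange,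
    for fixed \<open>d\<close>, the arguments \<open>x - u\<close> are distinct points below
    \<open>x - d\<close>.\<close>
  have "(\<Sum>d<i. int d * f (x - int d)) = (\<Sum>u<i. \<Sum>d | d \<in> {..<i} \<and> d < u. f (x - int u))"
  proof (rule sum.cong[OF refl])
    fix u assume "u \<in> {..<i}"
    then have "{d. d \<in> {..<i} \<and> d < u} = {..<u}" by auto
    then show "int u * f (x - int u) = (\<Sum>d | d \<in> {..<i} \<and> d < u. f (x - int u))" by simp
  qed
  also have "\<dots> = (\<Sum>d<i. \<Sum>u | u \<in> {..<i} \<and> d < u. f (x - int u))"
    by (rule sum.swap_restrict) auto
  also have "\<dots> \<le> (\<Sum>d<i. S (x - int d))"
  proof (rule sum_mono)
    fix d
    have "(\<Sum>u | u \<in> {..<i} \<and> d < u. f (x - int u))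
        = (\<Sum>y\<in>(\<lambda>u. x - int u) ` {u. u \<in> {..<i} \<and> d < u}. f y)"
      by (subst sum.reindex) (auto simp: inj_on_def)
    also have "\<dots> = (\<Sum>y\<in>(\<lambda>u. x - int u) ` {u. u \<in> {..<i} \<and> d < u} \<inter> {0..}. f y)"
      by (rule sum.mono_neutral_right) (auto intro!: neg)
    also have "\<dots> \<le> S (x - int d)"
      unfolding S_def by (rule sum_mono2) (auto simp: nonneg)
    finally show "(\<Sum>u | u \<in> {..<i} \<and> d < u. f (x - int u)) \<le> S (x - int d)" .
  qed
  finally have 1: "(\<Sum>d<i. int d * f (x - int d)) \<le> (\<Sum>d<i. S (x - int d))" .
  have 2: "(\<Sum>d<i. (x - int d) * f (x - int d)) \<le> (\<Sum>d<i. p * S (x - int d))"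
    unfolding S_def by (rule sum_mono) (rule moment)
  have "x * window i f x = (\<Sum>d<i. (x - int d) * f (x - int d)) + (\<Sum>d<i. int d * f (x - int d))"
    unfolding window_def sum_distrib_left sum.distrib[symmetric]
    by (rule sum.cong) (auto simp: algebra_simps)
  with 1 2 show ?thesis unfolding total by (simp add: sum_distrib_left[symmetric] algebra_simps)
qed

text \<open>The sum in \<open>moment\<close>, times the increment, is at most
  \<open>f (x - 1) * f x\<close>. Multiplying the moment inequality by the increment and cancelling
  \<open>f x\<close> gives the claim, hence the separate case \<open>f x = 0\<close>.\<close>

lemma log_concave_increment_le:
  assumes f: "log_concave f"
    and moment: "x * f x \<le> p * (\<Sum>y\<in>{0..<x}. f y)"
    and mono: "f (x - 1) \<le> f x" and "0 \<le> p"
  shows "x * (f x - f (x - 1)) \<le> p * f (x - 1)"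
proof (cases "f x = 0")
  case True
  with mono f have "f (x - 1) = 0" by (simp add: log_concave_def order.antisym)
  with True show ?thesis by simp
next
  case False
  have nonneg: "0 \<le> f x" for x using f by (simp add: log_concave_def)
  with False have pos: "0 < f x" by (simp add: order.not_eq_order_implies_strict)
  define S where "S = (\<Sum>y\<in>{0..<x}. f y)"
  \<comment> \<open>Log-concavity makes the sequence decay geometrically to the left of \<open>x\<close>, which bounds \<open>S\<close>.\<close>
  have "S * f x \<le> (\<Sum>y\<in>{0..<x}. f (y + 1) * f (x - 1))"
    unfolding S_def sum_distrib_right
    by (rule sum_mono, rule log_concave_spread[OF f]) auto
  also have "\<dots> = f (x - 1) * (\<Sum>y\<in>{0..<x}. f (y + 1))"
    by (simp add: sum_distrib_left mult.commute)
  also have "(\<Sum>y\<in>{0..<x}. f (y + 1)) = (\<Sum>y\<in>{1..x}. f y)"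
    by (rule sum.reindex_bij_witness[of _ "\<lambda>y. y - 1" "\<lambda>y. y + 1"]) auto
  also have "\<dots> \<le> (\<Sum>y\<in>insert x {0..<x}. f y)"
    by (rule sum_mono2) (auto simp: nonneg)
  also have "\<dots> = f x + S" by (simp add: S_def)
  finally have "S * f x \<le> f (x - 1) * (f x + S)" using nonneg by (simp add: mult_left_mono)
  then have "S * (f x - f (x - 1)) \<le> f (x - 1) * f x" by (simp add: algebra_simps)
  then have "p * (S * (f x - f (x - 1))) \<le> p * (f (x - 1) * f x)"
    using \<open>0 \<le> p\<close> by (rule mult_left_mono)
  moreover have "(x * f x) * (f x - f (x - 1)) \<le> (p * S) * (f x - f (x - 1))"
    using moment mono unfolding S_def by (intro mult_right_mono) auto
  ultimately have "f x * (x * (f x - f (x - 1))) \<le> f x * (p * f (x - 1))"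
    by (simp add: algebra_simps)
  then show ?thesis using pos by simp
qed

subsection \<open>Coefficients of products of q-integers\<close>

definition qint :: "nat \<Rightarrow> int poly" where
  "qint i = (\<Sum>d<i. monom 1 d)"

text \<open>Extension by zero to negative arguments lets shifts and windows avoid truncated
  subtraction.\<close>

definition coeff_int :: "int poly \<Rightarrow> int \<Rightarrow> int" where
  "coeff_int Q x = (if x < 0 then 0 else coeff Q (nat x))"

lemma coeff_int_mult_qint: "coeff_int (qint i * Q) = window i (coeff_int Q)"
proof
  fix x
  show "coeff_int (qint i * Q) x = window i (coeff_int Q) x"
  proof (cases "x < 0")
    case True
    then show ?thesis by (simp add: coeff_int_def window_def)
  next
    case False
    then show ?thesis
      by (auto simp: coeff_int_def window_def qint_def sum_distrib_right coeff_sum coeff_monom_mult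
          nat_diff_distrib' not_less intro!: sum.cong)
  qed
qed

text \<open>This turns out to be the number of permutations of \<open>[n]\<close> with \<open>x\<close> inversions that are
  increasing on a given block of \<open>k\<close> consecutive positions.\<close>

definition inc_coeff :: "nat \<Rightarrow> nat \<Rightarrow> int \<Rightarrow> int" where
  "inc_coeff k n = coeff_int (\<Prod>i\<in>{k<..n}. qint i)"

text \<open>The degree of the product in \<open>inc_coeff\<close>; half of it is the centre of
  symmetry.\<close>

definition inc_degree :: "nat \<Rightarrow> nat \<Rightarrow> int" where
  "inc_degree k n = (\<Sum>i\<in>{k<..n}. int i - 1)"

lemma greaterThanAtMost_Suc: "k \<le> n \<Longrightarrow> {k<..Suc n} = insert (Suc n) {k<..n}"
  by auto

lemma inc_coeff_refl: "inc_coeff k k x = (if x = 0 then 1 else 0)"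
  by (auto simp: inc_coeff_def coeff_int_def)

lemma inc_coeff_Suc: "k \<le> n \<Longrightarrow> inc_coeff k (Suc n) = window (Suc n) (inc_coeff k n)"
  unfolding inc_coeff_def by (simp add: greaterThanAtMost_Suc coeff_int_mult_qint)

lemma inc_degree_refl: "inc_degree k k = 0"
  by (simp add: inc_degree_def)

lemma inc_degree_Suc: "k \<le> n \<Longrightarrow> inc_degree k (Suc n) = inc_degree k n + int n"
  unfolding inc_degree_def by (simp add: greaterThanAtMost_Suc)

lemma inc_coeff_neg: "x < 0 \<Longrightarrow> inc_coeff k n x = 0"
  by (simp add: inc_coeff_def coeff_int_def)

lemma log_concave_inc_coeff: "k \<le> n \<Longrightarrow> log_concave (inc_coeff k n)"
proof (induction n rule: dec_induct)
  case base
  show ?case by (auto simp: log_concave_def inc_coeff_refl)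
next
  case (step n)
  then show ?case by (simp add: inc_coeff_Suc log_concave_window)
qed

text \<open>Reflection turns a window into one read from its other end; width \<open>Suc n\<close>
  raises the degree by \<open>n\<close>.\<close>

lemma inc_coeff_symmetric: "k \<le> n \<Longrightarrow> inc_coeff k n (inc_degree k n - x) = inc_coeff k n x"
proof (induction n arbitrary: x rule: dec_induct)
  case base
  show ?case by (auto simp: inc_coeff_refl inc_degree_refl)
next
  case (step n)
  have "window (Suc n) (inc_coeff k n) (inc_degree k n + int n - x)
      = (\<Sum>d<Suc n. inc_coeff k n (inc_degree k n - (x - int d)))"
    unfolding window_reverse by (rule sum.cong) (auto simp: algebra_simps)
  also have "\<dots> = window (Suc n) (inc_coeff k n) x"
    unfolding window_def by (simp only: step.IH)
  finally show ?case using step by (simp add: inc_coeff_Suc inc_degree_Suc)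
qed

lemma inc_coeff_pos:
  "k \<le> n \<Longrightarrow> 0 \<le> x \<Longrightarrow> x \<le> inc_degree k n \<Longrightarrow> 0 < inc_coeff k n x"
proof (induction n arbitrary: x rule: dec_induct)
  case base
  then show ?case by (auto simp: inc_coeff_refl inc_degree_refl)
next
  case (step n)
  have nonneg: "0 \<le> inc_coeff k n y" for y
    using log_concave_inc_coeff[OF step.hyps(1)] by (simp add: log_concave_def)
  have deg: "0 \<le> inc_degree k n" unfolding inc_degree_def by (rule sum_nonneg) auto
  \<comment> \<open>The smallest shift that brings \<open>x\<close> into the range of the induction
    hypothesis; it is at most \<open>n\<close> because the degree grows by \<open>n\<close>.\<close>
  define d where "d = nat (max 0 (x - inc_degree k n))"
  have "d < Suc n" "0 \<le> x - int d" "x - int d \<le> inc_degree k n"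
    using step.prems step.hyps deg by (auto simp: d_def inc_degree_Suc)
  then have "0 < window (Suc n) (inc_coeff k n) x"
    unfolding window_def using step.IH[of "x - int d"] nonneg
    by (intro sum_pos2[of _ d]) auto
  then show ?case using step by (simp add: inc_coeff_Suc)
qed

text \<open>At first all mass sits at \<open>0\<close>, and each of the \<open>n - k\<close> factors
  raises the constant by one.\<close>

lemma inc_coeff_moment:
  "k \<le> n \<Longrightarrow> x * inc_coeff k n x \<le> int (n - k) * (\<Sum>y\<in>{0..<x}. inc_coeff k n y)"
proof (induction n arbitrary: x rule: dec_induct)
  case base
  then show ?case by (auto simp: inc_coeff_refl)
next
  case (step n)
  have "x * window (Suc n) (inc_coeff k n) x
      \<le> (int (n - k) + 1) * (\<Sum>y\<in>{0..<x}. window (Suc n) (inc_coeff k n) y)"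
    using log_concave_inc_coeff[OF step.hyps(1)] step.IH
    by (intro window_moment_le) (auto simp: log_concave_def inc_coeff_neg)
  then show ?case using step by (simp add: inc_coeff_Suc Suc_diff_le algebra_simps)
qed

lemma inc_degree_eq: "k \<le> n \<Longrightarrow> 2 * inc_degree k n = int n * (int n - 1) - int k * (int k - 1)"
proof (induction n rule: dec_induct)
  case base
  show ?case by (simp add: inc_degree_refl)
next
  case (step n)
  then show ?case by (simp add: inc_degree_Suc algebra_simps)
qed

lemma inc_coeff_mono:
  assumes "k \<le> n" "x \<le> y" "2 * y \<le> inc_degree k n"
  shows "inc_coeff k n x \<le> inc_coeff k n y"
  using assms(2,3)
proof (induction y rule: int_ge_induct)
  case base
  show ?case by simp
next
  case (step y)
  have "inc_coeff k n (y + 1 - 1) \<le> inc_coeff k n (y + 1)"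
    using assms step.prems
    by (intro log_concave_symmetric_mono[of _ "inc_degree k n"] log_concave_inc_coeff
        inc_coeff_symmetric)
  with step show ?case by simp
qed

text \<open>Telescope over \<open>t\<close> unit steps, each bounded by
  \<open>log_concave_increment_le\<close>. Since \<open>2 * t \<le> m\<close>, every step starts at
  an argument of at least \<open>m / 2\<close>, which gives the factor 2.\<close>

lemma inc_coeff_diff_le:
  assumes kn: "k \<le> n" and m: "2 * int m \<le> inc_degree k n" and t: "2 * t \<le> m" and "0 < m"
  shows "real_of_int (inc_coeff k n (int m) - inc_coeff k n (int m - int t))
           \<le> 2 * real t * real n / real m * real_of_int (inc_coeff k n (int m))"
  using t
proof (induction t)
  case 0
  then show ?case by simp
next
  case (Suc t)
  define f where "f = inc_coeff k n"
  define x where "x = int m - int t"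
  have x: "2 * x \<le> inc_degree k n" "int m \<le> 2 * x" using m Suc.prems by (auto simp: x_def)
  have nonneg: "0 \<le> f y" for y
    using log_concave_inc_coeff[OF kn] by (simp add: log_concave_def f_def)
  have "x * (f x - f (x - 1)) \<le> int (n - k) * f (x - 1)"
    unfolding f_def
    by (intro log_concave_increment_le log_concave_inc_coeff inc_coeff_moment inc_coeff_mono)
      (use kn x in auto)
  also have "\<dots> \<le> int n * f (int m)"
    unfolding f_def by (intro mult_mono inc_coeff_mono) (use kn m x nonneg in \<open>auto simp: x_def f_def\<close>)
  finally have 1: "x * (f x - f (x - 1)) \<le> int n * f (int m)" .
  have "f (x - 1) \<le> f x" unfolding f_def by (rule inc_coeff_mono) (use kn x in auto)
  then have "int m * (f x - f (x - 1)) \<le> 2 * x * (f x - f (x - 1))"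
    using x by (intro mult_right_mono) auto
  with 1 have "int m * (f x - f (x - 1)) \<le> 2 * (int n * f (int m))" by simp
  then have "real_of_int (int m * (f x - f (x - 1))) \<le> real_of_int (2 * (int n * f (int m)))"
    by (simp only: of_int_le_iff)
  then have "real_of_int (f x - f (x - 1)) \<le> 2 * real n / real m * real_of_int (f (int m))"
    using \<open>0 < m\<close> by (simp add: field_simps)
  moreover have "real_of_int (f (int m) - f x)
      \<le> 2 * real t * real n / real m * real_of_int (f (int m))"
    using Suc by (simp add: f_def x_def)
  ultimately show ?case
    by (simp add: f_def[symmetric] x_def algebra_simps add_divide_distrib)
qed

subsection \<open>Inversions of permutations increasing on a block\<close>

definition inv_on :: "nat set \<Rightarrow> (nat \<Rightarrow> nat) \<Rightarrow> (nat \<times> nat) set" where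
  "inv_on A \<sigma> = {(x, y). x \<in> A \<and> y \<in> A \<and> x < y \<and> \<sigma> y < \<sigma> x}"

definition inc_perms :: "nat set \<Rightarrow> nat set \<Rightarrow> (nat \<Rightarrow> nat) set" where
  "inc_perms A B = {\<sigma>. \<sigma> permutes A \<and> strict_mono_on B \<sigma>}"

text \<open>The generating function of the inversion number, in which additivity of inversion
  numbers becomes a product.\<close>

definition inv_poly :: "nat set \<Rightarrow> (nat \<Rightarrow> nat) set \<Rightarrow> int poly" where
  "inv_poly A P = (\<Sum>\<sigma>\<in>P. monom 1 (card (inv_on A \<sigma>)))"

lemma finite_inv_on: "finite A \<Longrightarrow> finite (inv_on A \<sigma>)"
  by (rule finite_subset[of _ "A \<times> A"]) (auto simp: inv_on_def)

lemma coeff_inv_poly: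
  "finite P \<Longrightarrow> coeff (inv_poly A P) m = int (card {\<sigma> \<in> P. card (inv_on A \<sigma>) = m})"
  by (simp add: inv_poly_def coeff_sum sum.If_cases Int_def)

section \<open>Permutations determined by relative order\<close>

text \<open>Passing to a larger element \<open>y\<close> of \<open>C\<close> removes at least
  \<open>y\<close> itself from the set of larger elements, so the rank from the top is
  injective.\<close>

lemma eq_if_card_greater_eq:
  fixes u v :: nat
  assumes "finite C" "u \<in> C" "v \<in> C" "card {z \<in> C. u < z} = card {z \<in> C. v < z}"
  shows "u = v"
proof -
  have "card {z \<in> C. y < z} < card {z \<in> C. x < z}" if "x < y" "y \<in> C" for x y
    using that assms(1) by (intro psubset_card_mono) auto
  with assms show ?thesis by (metis less_irrefl linorder_neqE_nat)
qed

lemma eq_on_if_same_order: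
  fixes f g :: "nat \<Rightarrow> nat"
  assumes fin: "finite B" and inj: "inj_on f B" "inj_on g B" and im: "f ` B = g ` B"
    and ord: "\<And>x y. x \<in> B \<Longrightarrow> y \<in> B \<Longrightarrow> f x < f y \<longleftrightarrow> g x < g y" and x: "x \<in> B"
  shows "f x = g x"
proof (rule eq_if_card_greater_eq[of "f ` B"])
  have count: "card {z \<in> h ` B. h x < z} = card {y \<in> B. h x < h y}" if "inj_on h B" for h :: "nat \<Rightarrow> nat"
  proof -
    have "{z \<in> h ` B. h x < z} = h ` {y \<in> B. h x < h y}" by auto
    then show ?thesis using that by (simp add: card_image inj_on_def)
  qed
  have "{y \<in> B. f x < f y} = {y \<in> B. g x < g y}" using ord x by auto
  then show "card {z \<in> f ` B. f x < z} = card {z \<in> f ` B. g x < z}"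
    using count[OF inj(1)] count[OF inj(2)] im by simp
qed (use fin x im in auto)

lemma permutes_eq_if_same_order:
  fixes f g :: "nat \<Rightarrow> nat"
  assumes "finite B" "f permutes B" "g permutes B"
    and "\<And>x y. x \<in> B \<Longrightarrow> y \<in> B \<Longrightarrow> f x < f y \<longleftrightarrow> g x < g y"
  shows "f = g"
proof
  fix x
  show "f x = g x"
  proof (cases "x \<in> B")
    case True
    then show ?thesis
      using assms by (intro eq_on_if_same_order[of B]) (auto simp: permutes_inj_on permutes_image)
  next
    case False
    then show ?thesis using assms(2,3) by (simp add: permutes_not_in)
  qed
qed

text \<open>Standardization of \<open>\<sigma>\<close> on \<open>B\<close>: each value is replaced
  by the element of \<open>B\<close> of the same rank.\<close>

lemma ex_permutes_same_order:
  fixes \<sigma> :: "nat \<Rightarrow> nat"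
  assumes fin: "finite B" and inj: "inj_on \<sigma> B"
  obtains \<rho> where "\<rho> permutes B"
    and "\<And>x y. x \<in> B \<Longrightarrow> y \<in> B \<Longrightarrow> \<rho> x < \<rho> y \<longleftrightarrow> \<sigma> x < \<sigma> y"
proof -
  obtain h where h: "bij_betw h {..<card B} B" "strict_mono_on {..<card B} h"
    using ex_bij_betw_strict_mono_card[OF fin] by (metis atLeast0LessThan)
  have "card (\<sigma> ` B) = card B" using inj by (rule card_image)
  then obtain g where g: "bij_betw g {..<card B} (\<sigma> ` B)" "strict_mono_on {..<card B} g"
    using ex_bij_betw_strict_mono_card[of "\<sigma> ` B"] fin by (metis finite_imageI atLeast0LessThan)
  define r where "r x = the_inv_into {..<card B} g (\<sigma> x)" for x
  have r: "bij_betw r B {..<card B}"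
    unfolding r_def using bij_betw_trans[OF inj_on_imp_bij_betw[OF inj] bij_betw_the_inv_into[OF g(1)]]
    by (simp add: o_def)
  have gr: "g (r x) = \<sigma> x" if "x \<in> B" for x
    unfolding r_def using g(1) that by (auto simp: bij_betw_def intro!: f_the_inv_into_f)
  have rB: "r x \<in> {..<card B}" if "x \<in> B" for x using r that by (auto simp: bij_betw_def)
  define \<rho> where "\<rho> x = (if x \<in> B then h (r x) else x)" for x
  have "bij_betw (\<lambda>x. h (r x)) B B" using bij_betw_trans[OF r h(1)] by (simp add: o_def)
  then have "bij_betw \<rho> B B" by (subst bij_betw_cong[where g = "\<lambda>x. h (r x)"]) (auto simp: \<rho>_def)
  then have "\<rho> permutes B" by (rule bij_imp_permutes) (simp add: \<rho>_def)
  moreover have "\<rho> x < \<rho> y \<longleftrightarrow> \<sigma> x < \<sigma> y" if "x \<in> B" "y \<in> B" for x y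
  proof -
    have "\<rho> x < \<rho> y \<longleftrightarrow> r x < r y"
      using strict_mono_on_less[OF h(2) rB rB] that by (simp add: \<rho>_def)
    also have "\<dots> \<longleftrightarrow> g (r x) < g (r y)"
      using strict_mono_on_less[OF g(2) rB rB] that by simp
    finally show ?thesis using that by (simp add: gr)
  qed
  ultimately show thesis using that by blast
qed

section \<open>Unique factorization through a block\<close>

text \<open>\<open>inv \<rho>\<close> lists the positions in \<open>B\<close> by increasing value of
  \<open>\<sigma>\<close>, so the composition is sorted on \<open>B\<close>.\<close>

lemma comp_inv_in_inc_perms:
  assumes \<sigma>: "\<sigma> permutes A" and \<rho>: "\<rho> permutes B" and BA: "B \<subseteq> A"
    and ord: "\<And>x y. x \<in> B \<Longrightarrow> y \<in> B \<Longrightarrow> \<rho> x < \<rho> y \<longleftrightarrow> \<sigma> x < \<sigma> y"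
  shows "\<sigma> \<circ> inv \<rho> \<in> inc_perms A B"
proof -
  have inv: "inv \<rho> permutes B" using \<rho> by (rule permutes_inv)
  have "strict_mono_on B (\<sigma> \<circ> inv \<rho>)"
  proof (rule strict_mono_onI)
    fix x y assume xy: "x \<in> B" "y \<in> B" "x < y"
    then have "inv \<rho> x \<in> B" "inv \<rho> y \<in> B" using inv by (simp_all add: permutes_in_image)
    from ord[OF this] show "(\<sigma> \<circ> inv \<rho>) x < (\<sigma> \<circ> inv \<rho>) y"
      using xy \<rho> by (simp add: permutes_inverses)
  qed
  moreover have "\<sigma> \<circ> inv \<rho> permutes A"
    using permutes_subset[OF inv BA] \<sigma> by (rule permutes_compose)
  ultimately show ?thesis by (simp add: inc_perms_def)
qed

lemma inc_perms_comp_same_order: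
  assumes "\<sigma> \<in> inc_perms A B" "\<rho> permutes B" "x \<in> B" "y \<in> B"
  shows "(\<sigma> \<circ> \<rho>) x < (\<sigma> \<circ> \<rho>) y \<longleftrightarrow> \<rho> x < \<rho> y"
  using assms strict_mono_on_less[of B \<sigma> "\<rho> x" "\<rho> y"]
  by (simp add: inc_perms_def permutes_in_image)

text \<open>On \<open>B\<close> the product is ordered as \<open>\<rho>\<close> is, which determines
  \<open>\<rho>\<close> and then, by cancellation, \<open>\<sigma>\<close>. Sorting on
  \<open>B\<close> gives existence.\<close>

lemma bij_betw_inc_perms_comp:
  assumes fin: "finite B" and BA: "B \<subseteq> A"
  shows "bij_betw (\<lambda>(\<rho>, \<sigma>). \<sigma> \<circ> \<rho>) ({\<rho>. \<rho> permutes B} \<times> inc_perms A B) {\<sigma>. \<sigma> permutes A}"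
proof (rule bij_betwI')
  fix p q
  assume p: "p \<in> {\<rho>. \<rho> permutes B} \<times> inc_perms A B" and q: "q \<in> {\<rho>. \<rho> permutes B} \<times> inc_perms A B"
  obtain \<rho> \<sigma> \<rho>' \<sigma>' where pq: "p = (\<rho>, \<sigma>)" "q = (\<rho>', \<sigma>')" by fastforce
  have "\<rho> = \<rho>' \<and> \<sigma> = \<sigma>'" if eq: "\<sigma> \<circ> \<rho> = \<sigma>' \<circ> \<rho>'"
  proof -
    have "\<rho> = \<rho>'"
    proof (rule permutes_eq_if_same_order[OF fin])
      fix x y assume "x \<in> B" "y \<in> B"
      then show "\<rho> x < \<rho> y \<longleftrightarrow> \<rho>' x < \<rho>' y"
        using p q inc_perms_comp_same_order[of \<sigma> A B \<rho> x y]
          inc_perms_comp_same_order[of \<sigma>' A B \<rho>' x y] by (simp add: pq eq)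
    qed (use p q pq in auto)
    moreover from this have "\<sigma> = \<sigma>'"
      using eq p by (metis (mono_tags) pq(1) SigmaD1 mem_Collect_eq comp_assoc comp_id permutes_inv_o(1))
    ultimately show ?thesis by simp
  qed
  then show "(case p of (\<rho>, \<sigma>) \<Rightarrow> \<sigma> \<circ> \<rho>) = (case q of (\<rho>, \<sigma>) \<Rightarrow> \<sigma> \<circ> \<rho>) \<longleftrightarrow> p = q"
    by (auto simp: pq)
next
  fix p assume "p \<in> {\<rho>. \<rho> permutes B} \<times> inc_perms A B"
  then show "(case p of (\<rho>, \<sigma>) \<Rightarrow> \<sigma> \<circ> \<rho>) \<in> {\<sigma>. \<sigma> permutes A}"
    using BA by (auto simp: inc_perms_def intro: permutes_compose permutes_subset)
next
  fix \<sigma> assume "\<sigma> \<in> {\<sigma>. \<sigma> permutes A}"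
  then have \<sigma>: "\<sigma> permutes A" by simp
  obtain \<rho> where \<rho>: "\<rho> permutes B"
    and ord: "\<And>x y. x \<in> B \<Longrightarrow> y \<in> B \<Longrightarrow> \<rho> x < \<rho> y \<longleftrightarrow> \<sigma> x < \<sigma> y"
    using ex_permutes_same_order[OF fin permutes_inj_on[OF \<sigma>]] by blast
  have "\<sigma> = (\<sigma> \<circ> inv \<rho>) \<circ> \<rho>" using \<rho> by (simp add: comp_assoc permutes_inv_o)
  with comp_inv_in_inc_perms[OF \<sigma> \<rho> BA ord] \<rho>
  show "\<exists>p\<in>{\<rho>. \<rho> permutes B} \<times> inc_perms A B. \<sigma> = (case p of (\<rho>, \<sigma>) \<Rightarrow> \<sigma> \<circ> \<rho>)"
    by (intro bexI[of _ "(\<rho>, \<sigma> \<circ> inv \<rho>)"]) auto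
qed

text \<open>Inside \<open>B\<close> the product inverts exactly what \<open>\<rho>\<close> inverts,
  because \<open>\<sigma>\<close> increases there. On all other pairs \<open>\<rho>\<close>
  preserves the order of positions, so it carries the remaining inversions onto those of
  \<open>\<sigma>\<close>, none of which lies inside \<open>B\<close>.\<close>

lemma card_inv_on_comp:
  assumes fin: "finite A" and BA: "B \<subseteq> A"
    and conv: "\<And>x y z. x \<in> B \<Longrightarrow> z \<in> B \<Longrightarrow> y \<in> A \<Longrightarrow> x < y \<Longrightarrow> y < z \<Longrightarrow> y \<in> B"
    and \<sigma>: "\<sigma> \<in> inc_perms A B" and \<rho>: "\<rho> permutes B"
  shows "card (inv_on A (\<sigma> \<circ> \<rho>)) = card (inv_on B \<rho>) + card (inv_on A \<sigma>)"
proof -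
  have inB: "\<rho> x \<in> B \<longleftrightarrow> x \<in> B" for x using \<rho> by (rule permutes_in_image)
  have out: "\<rho> x = x" if "x \<notin> B" for x using \<rho> that by (rule permutes_not_in)
  have inA: "\<rho> x \<in> A \<longleftrightarrow> x \<in> A" for x using inB[of x] out[of x] BA by (cases "x \<in> B") auto
  \<comment> \<open>By \<open>conv\<close>, a position of \<open>A\<close> outside \<open>B\<close>
    cannot separate a position of \<open>B\<close> from its image under
    \<open>\<rho>\<close>.\<close>
  have mono: "\<rho> x < \<rho> y \<longleftrightarrow> x < y" if "x \<in> A" "y \<in> A" "\<not> (x \<in> B \<and> y \<in> B)" for x y
    using that conv[of x "\<rho> x" y] conv[of "\<rho> x" x y] conv[of y "\<rho> y" x] conv[of "\<rho> y" y x]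
    by (metis inB inA out linorder_neqE_nat)
  have inside: "inv_on A (\<sigma> \<circ> \<rho>) \<inter> B \<times> B = inv_on B \<rho>"
    using inc_perms_comp_same_order[OF \<sigma> \<rho>] BA by (auto simp: inv_on_def)
  have "bij_betw (\<lambda>(x, y). (\<rho> x, \<rho> y)) (inv_on A (\<sigma> \<circ> \<rho>) - B \<times> B) (inv_on A \<sigma>)"
  proof (rule bij_betwI')
    fix p q
    show "(case p of (x, y) \<Rightarrow> (\<rho> x, \<rho> y)) = (case q of (x, y) \<Rightarrow> (\<rho> x, \<rho> y)) \<longleftrightarrow> p = q"
      using permutes_inj[OF \<rho>] by (auto simp: inj_eq split: prod.splits)
  next
    fix p assume "p \<in> inv_on A (\<sigma> \<circ> \<rho>) - B \<times> B"
    then show "(case p of (x, y) \<Rightarrow> (\<rho> x, \<rho> y)) \<in> inv_on A \<sigma>"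
      using mono by (auto simp: inv_on_def inA)
  next
    fix p assume p: "p \<in> inv_on A \<sigma>"
    obtain x y where xy: "p = (x, y)" by fastforce
    have "\<not> (x \<in> B \<and> y \<in> B)"
      using p \<sigma> by (auto simp: xy inv_on_def inc_perms_def dest!: strict_mono_onD[of B \<sigma> x y])
    moreover obtain x' y' where "x = \<rho> x'" "y = \<rho> y'"
      using permutes_surj[OF \<rho>] by (metis surjD)
    ultimately show "\<exists>p'\<in>inv_on A (\<sigma> \<circ> \<rho>) - B \<times> B. p = (case p' of (x, y) \<Rightarrow> (\<rho> x, \<rho> y))"
      using p mono[of x' y'] by (intro bexI[of _ "(x', y')"]) (auto simp: xy inv_on_def inA inB)
  qed
  then have "card (inv_on A (\<sigma> \<circ> \<rho>) - B \<times> B) = card (inv_on A \<sigma>)" by (rule bij_betw_same_card)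
  moreover have "inv_on A (\<sigma> \<circ> \<rho>) = inv_on B \<rho> \<union> (inv_on A (\<sigma> \<circ> \<rho>) - B \<times> B)" using inside by auto
  moreover have "card (inv_on B \<rho> \<union> (inv_on A (\<sigma> \<circ> \<rho>) - B \<times> B))
      = card (inv_on B \<rho>) + card (inv_on A (\<sigma> \<circ> \<rho>) - B \<times> B)"
    using fin BA inside by (intro card_Un_disjoint) (auto simp: finite_inv_on finite_subset)
  ultimately show ?thesis by simp
qed

lemma inv_poly_factor:
  assumes fin: "finite A" and BA: "B \<subseteq> A"
    and conv: "\<And>x y z. x \<in> B \<Longrightarrow> z \<in> B \<Longrightarrow> y \<in> A \<Longrightarrow> x < y \<Longrightarrow> y < z \<Longrightarrow> y \<in> B"
  shows "inv_poly A {\<sigma>. \<sigma> permutes A} = inv_poly B {\<rho>. \<rho> permutes B} * inv_poly A (inc_perms A B)"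
proof -
  have "finite B" using fin BA by (rule finite_subset[rotated])
  have "inv_poly A {\<sigma>. \<sigma> permutes A}
      = (\<Sum>(\<rho>, \<sigma>)\<in>{\<rho>. \<rho> permutes B} \<times> inc_perms A B. monom 1 (card (inv_on A (\<sigma> \<circ> \<rho>))))"
    unfolding inv_poly_def sum.reindex_bij_betw[OF bij_betw_inc_perms_comp[OF \<open>finite B\<close> BA], symmetric]
    by (simp add: case_prod_unfold)
  also have "\<dots> = (\<Sum>(\<rho>, \<sigma>)\<in>{\<rho>. \<rho> permutes B} \<times> inc_perms A B.
      monom 1 (card (inv_on B \<rho>)) * monom 1 (card (inv_on A \<sigma>)))"
    using card_inv_on_comp[OF fin BA conv] by (intro sum.cong) (auto simp: mult_monom)
  finally show ?thesis by (simp add: inv_poly_def sum_product sum.cartesian_product)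
qed

section \<open>Generating functions of inversion numbers\<close>

text \<open>A permutation increasing on \<open>A\<close> is determined by its value at the last
  position \<open>b\<close>. Its inversions all end at \<open>b\<close> and are counted by the
  elements above that value; this count takes each of \<open>0, ..., card A\<close> once.\<close>

lemma inv_poly_inc_perms_insert_Max:
  assumes fin: "finite A" and b: "\<And>a. a \<in> A \<Longrightarrow> a < b"
  shows "inv_poly (insert b A) (inc_perms (insert b A) A) = qint (Suc (card A))"
proof -
  define A' where "A' = insert b A"
  have bA: "b \<notin> A" using b by blast
  then have finA': "finite A'" and cardA': "card A' = Suc (card A)"
    using fin by (simp_all add: A'_def)
  define above where "above v = card {w \<in> A'. v < w}" for v
  have inj: "inj_on above A'"
    using eq_if_card_greater_eq[OF finA'] by (auto simp: inj_on_def above_def)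
  have "above ` A' = {..<Suc (card A)}"
  proof (rule card_subset_eq)
    show "above ` A' \<subseteq> {..<Suc (card A)}"
    proof
      fix c assume "c \<in> above ` A'"
      then obtain v where v: "v \<in> A'" "c = above v" by auto
      have "above v < card A'" unfolding above_def
        using finA' v by (intro psubset_card_mono) auto
      then show "c \<in> {..<Suc (card A)}" using v cardA' by simp
    qed
    show "card (above ` A') = card {..<Suc (card A)}" using inj cardA' by (simp add: card_image)
  qed simp
  with inj have bij_above: "bij_betw above A' {..<Suc (card A)}" by (simp add: bij_betw_def)
  have bij_val: "bij_betw (\<lambda>\<sigma>. \<sigma> b) (inc_perms A' A) A'"
  proof (rule bij_betwI')
    fix \<sigma> \<sigma>' assume \<sigma>: "\<sigma> \<in> inc_perms A' A" and \<sigma>': "\<sigma>' \<in> inc_perms A' A"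
    have p: "\<sigma> permutes A'" "\<sigma>' permutes A'" using \<sigma> \<sigma>' by (auto simp: inc_perms_def)
    have im: "f ` A = A' - {f b}" if "f permutes A'" for f
    proof -
      have "A = A' - {b}" using bA by (auto simp: A'_def)
      then have "f ` A = f ` A' - f ` {b}" using permutes_inj[OF that] by (simp add: image_set_diff)
      then show ?thesis using that by (simp add: permutes_image)
    qed
    have "\<sigma> = \<sigma>'" if eq: "\<sigma> b = \<sigma>' b"
    proof
      fix x
      have "\<sigma> x = \<sigma>' x" if "x \<in> A"
      proof (rule eq_on_if_same_order[OF fin permutes_inj_on permutes_inj_on _ _ that])
        show "\<sigma> ` A = \<sigma>' ` A" using im p eq by simp
        show "\<sigma> x < \<sigma> y \<longleftrightarrow> \<sigma>' x < \<sigma>' y" if "x \<in> A" "y \<in> A" for x y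
          using \<sigma> \<sigma>' that strict_mono_on_less[of A \<sigma> x y] strict_mono_on_less[of A \<sigma>' x y]
          by (simp add: inc_perms_def)
      qed (rule p)+
      then show "\<sigma> x = \<sigma>' x"
        using eq p by (cases "x \<in> A'") (auto simp: A'_def permutes_not_in)
    qed
    then show "\<sigma> b = \<sigma>' b \<longleftrightarrow> \<sigma> = \<sigma>'" by auto
  next
    fix \<sigma> assume "\<sigma> \<in> inc_perms A' A"
    then show "\<sigma> b \<in> A'" using permutes_in_image[of \<sigma> A' b] by (simp add: inc_perms_def A'_def)
  next
    fix v assume v: "v \<in> A'"
    \<comment> \<open>Any permutation sending \<open>b\<close> to \<open>v\<close> would do. Sorting
      it on \<open>A\<close> keeps the value at \<open>b\<close>, since \<open>inv \<rho>\<close>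
      fixes \<open>b\<close>.\<close>
    have t: "Transposition.transpose b v permutes A'" using v by (intro permutes_swap_id) (auto simp: A'_def)
    obtain \<rho> where \<rho>: "\<rho> permutes A"
      and ord: "\<And>x y. x \<in> A \<Longrightarrow> y \<in> A \<Longrightarrow> \<rho> x < \<rho> y \<longleftrightarrow> Transposition.transpose b v x < Transposition.transpose b v y"
      using ex_permutes_same_order[OF fin permutes_inj_on[OF t]] by blast
    have "Transposition.transpose b v \<circ> inv \<rho> \<in> inc_perms A' A"
      by (rule comp_inv_in_inc_perms[OF t \<rho> _ ord]) (auto simp: A'_def)
    moreover have "v = (Transposition.transpose b v \<circ> inv \<rho>) b"
      using permutes_not_in[OF permutes_inv[OF \<rho>] bA] by simp
    ultimately show "\<exists>\<sigma>\<in>inc_perms A' A. v = \<sigma> b" by blast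
  qed
  have card_inv: "card (inv_on A' \<sigma>) = above (\<sigma> b)" if \<sigma>: "\<sigma> \<in> inc_perms A' A" for \<sigma>
  proof -
    have p: "\<sigma> permutes A'" using \<sigma> by (simp add: inc_perms_def)
    have "bij_betw (\<lambda>(x, y). \<sigma> x) (inv_on A' \<sigma>) {w \<in> A'. \<sigma> b < w}"
    proof -
      have eq: "inv_on A' \<sigma> = (\<lambda>x. (x, b)) ` {x \<in> A. \<sigma> b < \<sigma> x}"
      proof -
        have "y = b \<and> x \<in> A" if "x \<in> A'" "y \<in> A'" "x < y" "\<sigma> y < \<sigma> x" for x y
        proof -
          have "\<not> (x \<in> A \<and> y \<in> A)"
            using \<sigma> that strict_mono_onD[of A \<sigma> x y] by (auto simp: inc_perms_def)
          with that show ?thesis using b[of y] by (auto simp: A'_def)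
        qed
        then show ?thesis using b by (auto simp: inv_on_def A'_def)
      qed
      have "\<sigma> ` {x \<in> A. \<sigma> b < \<sigma> x} = \<sigma> ` {x \<in> A'. \<sigma> b < \<sigma> x}" by (auto simp: A'_def)
      also have "\<dots> = {w \<in> \<sigma> ` A'. \<sigma> b < w}" by auto
      finally have "\<sigma> ` {x \<in> A. \<sigma> b < \<sigma> x} = {w \<in> A'. \<sigma> b < w}"
        using p by (simp add: permutes_image)
      then show ?thesis unfolding eq bij_betw_def
        using permutes_inj[OF p] by (auto simp: inj_on_def image_image dest: injD)
    qed
    then show ?thesis unfolding above_def by (rule bij_betw_same_card)
  qed
  have "inv_poly A' (inc_perms A' A) = (\<Sum>\<sigma>\<in>inc_perms A' A. monom 1 (above (\<sigma> b)))"
    unfolding inv_poly_def by (intro sum.cong) (auto simp: card_inv)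
  also have "\<dots> = (\<Sum>v\<in>A'. monom 1 (above v))"
    by (rule sum.reindex_bij_betw[OF bij_val])
  also have "\<dots> = qint (Suc (card A))"
    unfolding qint_def by (rule sum.reindex_bij_betw[OF bij_above])
  finally show ?thesis by (simp add: A'_def)
qed

text \<open>The classical q-factorial, obtained by adding a largest position: factoring through the
  block \<open>A\<close> yields one new q-integer.\<close>

lemma inv_poly_permutes:
  "finite A \<Longrightarrow> inv_poly A {\<sigma>. \<sigma> permutes A} = (\<Prod>i\<in>{0<..card A}. qint i)"
proof (induction A rule: finite_linorder_max_induct)
  case empty
  show ?case by (simp add: inv_poly_def inv_on_def)
next
  case (insert b A)
  have "inv_poly (insert b A) {\<sigma>. \<sigma> permutes insert b A}
      = inv_poly A {\<sigma>. \<sigma> permutes A} * inv_poly (insert b A) (inc_perms (insert b A) A)"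
    using insert by (intro inv_poly_factor) (auto dest: less_asym)
  moreover have "card (insert b A) = Suc (card A)" using insert by (subst card_insert_disjoint) auto
  ultimately show ?case
    using insert by (simp add: inv_poly_inc_perms_insert_Max greaterThanAtMost_Suc mult.commute)
qed

text \<open>Factor the q-factorial of \<open>n\<close> through the block, then cancel the
  q-factorial of \<open>k\<close>, whose factors are nonzero because their constant coefficients
  are.\<close>

lemma inv_poly_inc_perms_block:
  assumes "B = {j..<j + k}" "1 \<le> j" "j + k \<le> n + 1"
  shows "inv_poly {1..n} (inc_perms {1..n} B) = (\<Prod>i\<in>{k<..n}. qint i)"
proof -
  have "(\<Prod>i\<in>{0<..k}. qint i) * inv_poly {1..n} (inc_perms {1..n} B) = (\<Prod>i\<in>{0<..n}. qint i)"
  proof -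
    have "inv_poly {1..n} {\<sigma>. \<sigma> permutes {1..n}}
        = inv_poly B {\<rho>. \<rho> permutes B} * inv_poly {1..n} (inc_perms {1..n} B)"
      by (rule inv_poly_factor) (use assms in auto)
    then show ?thesis using inv_poly_permutes[of B] inv_poly_permutes[of "{1..n}"] assms(1) by simp
  qed
  also have "{0<..n} = {0<..k} \<union> {k<..n}" using assms by auto
  also have "(\<Prod>i\<in>\<dots>. qint i) = (\<Prod>i\<in>{0<..k}. qint i) * (\<Prod>i\<in>{k<..n}. qint i)"
    by (rule prod.union_disjoint) auto
  finally have "(\<Prod>i\<in>{0<..k}. qint i) * inv_poly {1..n} (inc_perms {1..n} B)
      = (\<Prod>i\<in>{0<..k}. qint i) * (\<Prod>i\<in>{k<..n}. qint i)" .
  moreover have "qint i \<noteq> 0" if "0 < i" for i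
  proof
    assume "qint i = 0"
    then have "coeff (qint i) 0 = 0" by simp
    then show False using that by (simp add: qint_def coeff_sum sum.If_cases Int_def)
  qed
  ultimately show ?thesis by simp
qed

section \<open>Counting by the order on a block\<close>

text \<open>Composition with \<open>\<rho>\<close> adds exactly
  \<open>card (inv_on B \<rho>)\<close> inversions to each permutation increasing on
  \<open>B\<close>, and reaches exactly those with the order of \<open>\<rho>\<close> there.\<close>

lemma card_perms_with_order:
  assumes B: "B = {j..<j + k}" "1 \<le> j" "j + k \<le> n + 1" and \<rho>: "\<rho> permutes B"
  shows "int (card {\<sigma> \<in> perms_with_inversions n m. \<forall>x\<in>B. \<forall>y\<in>B. \<sigma> x < \<sigma> y \<longleftrightarrow> \<rho> x < \<rho> y})
    = inc_coeff k n (int m - int (card (inv_on B \<rho>)))" (is "int (card ?S) = _")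
proof -
  let ?A = "{1..n}"
  define t where "t = card (inv_on B \<rho>)"
  have BA: "B \<subseteq> ?A" using B by auto
  have inv_comp: "card (inv_on ?A (\<sigma> \<circ> \<rho>)) = t + card (inv_on ?A \<sigma>)" if "\<sigma> \<in> inc_perms ?A B" for \<sigma>
    unfolding t_def by (rule card_inv_on_comp[OF _ BA _ that \<rho>]) (use B in auto)
  have inversions_eq: "inversions n \<sigma> = inv_on ?A \<sigma>" for \<sigma> by (auto simp: inversions_def inv_on_def)
  have "bij_betw (\<lambda>\<sigma>. \<sigma> \<circ> \<rho>) {\<sigma> \<in> inc_perms ?A B. t + card (inv_on ?A \<sigma>) = m} ?S"
  proof (rule bij_betwI')
    fix \<sigma> \<sigma>' :: "nat \<Rightarrow> nat"
    show "\<sigma> \<circ> \<rho> = \<sigma>' \<circ> \<rho> \<longleftrightarrow> \<sigma> = \<sigma>'"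
      using \<rho> by (metis comp_assoc comp_id permutes_inv_o(1))
  next
    fix \<sigma> assume \<sigma>: "\<sigma> \<in> {\<sigma> \<in> inc_perms ?A B. t + card (inv_on ?A \<sigma>) = m}"
    then have "\<sigma> \<circ> \<rho> permutes ?A"
      using permutes_subset[OF \<rho> BA] by (auto simp: inc_perms_def intro: permutes_compose)
    then show "\<sigma> \<circ> \<rho> \<in> ?S"
      using \<sigma> inc_perms_comp_same_order[of \<sigma> ?A B \<rho>] \<rho> inv_comp[of \<sigma>]
      by (auto simp: perms_with_inversions_def inversions_eq simp del: o_apply)
  next
    fix \<sigma> assume \<sigma>: "\<sigma> \<in> ?S"
    then have "\<sigma> \<circ> inv \<rho> \<in> inc_perms ?A B"
      by (intro comp_inv_in_inc_perms[OF _ \<rho> BA]) (auto simp: perms_with_inversions_def)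
    moreover have "\<sigma> = (\<sigma> \<circ> inv \<rho>) \<circ> \<rho>" using \<rho> by (simp add: comp_assoc permutes_inv_o)
    ultimately show "\<exists>\<sigma>'\<in>{\<sigma> \<in> inc_perms ?A B. t + card (inv_on ?A \<sigma>) = m}. \<sigma> = \<sigma>' \<circ> \<rho>"
      using \<sigma> inv_comp[of "\<sigma> \<circ> inv \<rho>"]
      by (intro bexI[of _ "\<sigma> \<circ> inv \<rho>"]) (auto simp: perms_with_inversions_def inversions_eq)
  qed
  then have card_S: "card ?S = card {\<sigma> \<in> inc_perms ?A B. t + card (inv_on ?A \<sigma>) = m}"
    by (simp add: bij_betw_same_card)
  have fin: "finite (inc_perms ?A B)"
    by (rule finite_subset[OF _ finite_permutations[of ?A]]) (auto simp: inc_perms_def)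
  show ?thesis
  \<comment> \<open>For \<open>t > m\<close> nothing is counted, and the zero extension of
    \<open>inc_coeff\<close> agrees.\<close>
  proof (cases "t \<le> m")
    case True
    then have "{\<sigma> \<in> inc_perms ?A B. t + card (inv_on ?A \<sigma>) = m}
        = {\<sigma> \<in> inc_perms ?A B. card (inv_on ?A \<sigma>) = m - t}" by auto
    with True show ?thesis
      unfolding card_S inc_coeff_def t_def[symmetric] inv_poly_inc_perms_block[OF B, symmetric]
      by (simp add: coeff_int_def coeff_inv_poly[OF fin[unfolded One_nat_def]] nat_diff_distrib')
  next
    case False
    then have "{\<sigma> \<in> inc_perms ?A B. t + card (inv_on ?A \<sigma>) = m} = {}" by auto
    with False show ?thesis unfolding card_S by (simp add: inc_coeff_neg t_def)
  qed
qed

text \<open>The orders on \<open>B\<close> partition the permutations. This expresses the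
  denominator of the probability through the same coefficients as the numerator.\<close>

lemma card_perms_with_inversions:
  assumes B: "B = {j..<j + k}" "1 \<le> j" "j + k \<le> n + 1"
  shows "int (card (perms_with_inversions n m))
    = (\<Sum>\<rho> | \<rho> permutes B. inc_coeff k n (int m - int (card (inv_on B \<rho>))))"
proof -
  define S where "S \<rho> = {\<sigma> \<in> perms_with_inversions n m. \<forall>x\<in>B. \<forall>y\<in>B. \<sigma> x < \<sigma> y \<longleftrightarrow> \<rho> x < \<rho> y}"
    for \<rho> :: "nat \<Rightarrow> nat"
  have finB: "finite B" using B by simp
  have fin: "finite (perms_with_inversions n m)"
    by (rule finite_subset[OF _ finite_permutations[of "{1..n}"]]) (auto simp: perms_with_inversions_def)
  have "perms_with_inversions n m = (\<Union>\<rho>\<in>{\<rho>. \<rho> permutes B}. S \<rho>)"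
  proof
    show "perms_with_inversions n m \<subseteq> (\<Union>\<rho>\<in>{\<rho>. \<rho> permutes B}. S \<rho>)"
    proof
      fix \<sigma> assume \<sigma>: "\<sigma> \<in> perms_with_inversions n m"
      then have "inj_on \<sigma> B" by (auto simp: perms_with_inversions_def intro: permutes_inj_on)
      from ex_permutes_same_order[OF finB this] show "\<sigma> \<in> (\<Union>\<rho>\<in>{\<rho>. \<rho> permutes B}. S \<rho>)"
        using \<sigma> unfolding S_def by (smt (verit) UN_I mem_Collect_eq)
    qed
  qed (auto simp: S_def)
  moreover have "card (\<Union>\<rho>\<in>{\<rho>. \<rho> permutes B}. S \<rho>) = (\<Sum>\<rho> | \<rho> permutes B. card (S \<rho>))"
  proof (rule card_UN_disjoint)
    show "\<forall>\<rho>\<in>{\<rho>. \<rho> permutes B}. \<forall>\<rho>'\<in>{\<rho>. \<rho> permutes B}. \<rho> \<noteq> \<rho>' \<longrightarrow> S \<rho> \<inter> S \<rho>' = {}"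
      using permutes_eq_if_same_order[OF finB] by (fastforce simp: S_def)
  qed (use fin finB in \<open>auto simp: S_def finite_permutations\<close>)
  ultimately show ?thesis
    using card_perms_with_order[OF B] by (simp add: S_def)
qed

subsection \<open>Occurrences of a pattern\<close>

text \<open>Conjugation by the shift from \<open>{1..k}\<close> to the block turns a pattern into
  the form that \<open>card_perms_with_order\<close> takes.\<close>

lemma permutes_shift_block:
  fixes j k :: nat
  assumes \<tau>: "\<tau> permutes {1..k}" and B: "B = {j..<j + k}" "1 \<le> j"
  shows "(\<lambda>x. if x \<in> B then \<tau> (x + 1 - j) + j - 1 else x) permutes B" (is "?\<rho> permutes B")
proof (rule bij_imp_permutes)
  have "bij_betw (\<lambda>x. x + 1 - j) B {1..k}"
    by (rule bij_betwI[where g = "\<lambda>a. a + j - 1"]) (use B in auto)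
  moreover have "bij_betw (\<lambda>a. a + j - 1) {1..k} B"
    by (rule bij_betwI[where g = "\<lambda>x. x + 1 - j"]) (use B in auto)
  ultimately have "bij_betw (\<lambda>x. \<tau> (x + 1 - j) + j - 1) B B"
    using bij_betw_trans[OF bij_betw_trans[OF _ permutes_imp_bij[OF \<tau>]]]
    by (fastforce simp: o_def)
  then show "bij_betw ?\<rho> B B" by (subst bij_betw_cong[where g = "\<lambda>x. \<tau> (x + 1 - j) + j - 1"]) auto
qed simp

lemma occurs_at_iff_same_order:
  assumes B: "B = {j..<j + k}" "1 \<le> j" "j + k \<le> n + 1"
    and \<rho>: "\<rho> = (\<lambda>x. if x \<in> B then \<tau> (x + 1 - j) + j - 1 else x)"
  shows "occurs_at k \<tau> j n \<sigma> \<longleftrightarrow> (\<forall>x\<in>B. \<forall>y\<in>B. \<sigma> x < \<sigma> y \<longleftrightarrow> \<rho> x < \<rho> y)"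
proof -
  have im: "B = (\<lambda>a. j + a - 1) ` {1..k}"
  proof
    show "B \<subseteq> (\<lambda>a. j + a - 1) ` {1..k}"
    proof
      fix x assume "x \<in> B"
      then show "x \<in> (\<lambda>a. j + a - 1) ` {1..k}"
        using B by (intro image_eqI[of _ _ "x + 1 - j"]) auto
    qed
  qed (use B in auto)
  have "\<rho> (j + a - 1) = \<tau> a + j - 1" if "a \<in> {1..k}" for a
    using that B by (auto simp: \<rho>)
  \<comment> \<open>\<open>1 \<le> j\<close> keeps the truncated subtraction from merging
    values.\<close>
  moreover have "\<tau> a + j - 1 < \<tau> b + j - 1 \<longleftrightarrow> \<tau> a < \<tau> b" for a b using B(2) by linarith
  ultimately show ?thesis using B(2,3) unfolding occurs_at_def im by simp
qed

section \<open>Bounds on the probability and the limit\<close>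

text \<open>The probability is one term \<open>g \<rho>\<close> over a sum of \<open>k!\<close>
  terms \<open>g \<pi>\<close>, all between \<open>(1 - \<epsilon>) * F\<close> and
  \<open>F\<close>.\<close>

lemma prob_occurs_at_bounds:
  fixes n m k j :: nat and \<epsilon> :: real
  assumes j: "1 \<le> j" "j + k \<le> n + 1" and \<tau>: "\<tau> permutes {1..k}"
    and m: "0 < m" "2 * int m \<le> inc_degree k n" "2 * k\<^sup>2 \<le> m"
    and \<epsilon>: "\<epsilon> = 2 * (real k)\<^sup>2 * real n / real m" "\<epsilon> < 1"
  defines "P \<equiv> measure_pmf.prob (pmf_of_set (perms_with_inversions n m)) {\<sigma>. occurs_at k \<tau> j n \<sigma>}"
  shows "1 - \<epsilon> \<le> P * fact k" "P * fact k \<le> 1 / (1 - \<epsilon>)"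
proof -
  define B where "B = {j..<j + k}"
  define \<rho> where "\<rho> = (\<lambda>x. if x \<in> B then \<tau> (x + 1 - j) + j - 1 else x)"
  define f where "f x = real_of_int (inc_coeff k n x)" for x
  define g where "g \<rho> = f (int m - int (card (inv_on B \<rho>)))" for \<rho>
  define F where "F = f (int m)"
  have kn: "k \<le> n" using j by simp
  have \<rho>: "\<rho> permutes B" unfolding \<rho>_def by (rule permutes_shift_block[OF \<tau> B_def j(1)])
  have F: "0 < F" unfolding F_def f_def using kn m by (simp add: inc_coeff_pos)
  have g: "(1 - \<epsilon>) * F \<le> g \<pi>" "g \<pi> \<le> F" for \<pi>
  proof -
    define t where "t = card (inv_on B \<pi>)"
    \<comment> \<open>The crude bound by all pairs costs only a constant factor in
      \<open>\<epsilon>\<close>.\<close>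
    have "t \<le> card (B \<times> B)"
      unfolding t_def by (rule card_mono) (auto simp: B_def inv_on_def)
    then have t: "t \<le> k\<^sup>2" by (simp add: B_def power2_eq_square)
    have "F - g \<pi> \<le> 2 * real t * real n / real m * F"
      using inc_coeff_diff_le[OF kn m(2) _ m(1), of t] t m(3)
      by (simp add: F_def g_def f_def t_def)
    also have "\<dots> \<le> \<epsilon> * F"
      unfolding \<epsilon> using t F of_nat_mono[OF t, where 'a = real]
      by (intro mult_right_mono divide_right_mono) auto
    finally show "(1 - \<epsilon>) * F \<le> g \<pi>" by (simp add: algebra_simps)
    show "g \<pi> \<le> F"
      unfolding g_def F_def f_def using inc_coeff_mono[OF kn _ m(2)] by simp
  qed
  have total: "real (card (perms_with_inversions n m)) = (\<Sum>\<pi> | \<pi> permutes B. g \<pi>)"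
    using arg_cong[OF card_perms_with_inversions[OF B_def j, of m], of real_of_int]
    by (simp add: g_def f_def)
  have card_perms: "card {\<pi>. \<pi> permutes B} = fact k"
    by (rule card_permutations) (auto simp: B_def)
  have lower: "fact k * ((1 - \<epsilon>) * F) \<le> real (card (perms_with_inversions n m))"
    using sum_bounded_below[of "{\<pi>. \<pi> permutes B}" "(1 - \<epsilon>) * F" g] g
    unfolding total card_perms by simp
  have upper: "real (card (perms_with_inversions n m)) \<le> fact k * F"
    using sum_bounded_above[of "{\<pi>. \<pi> permutes B}" g F] g
    unfolding total card_perms by simp
  \<comment> \<open>This shows that the sample space is nonempty, as \<open>pmf_of_set\<close>
    requires.\<close>
  have "0 < fact k * ((1 - \<epsilon>) * F)" using F \<epsilon>(2) by simp
  with lower have pos: "0 < real (card (perms_with_inversions n m))" by linarith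
  have "{\<sigma> \<in> perms_with_inversions n m. occurs_at k \<tau> j n \<sigma>}
      = {\<sigma> \<in> perms_with_inversions n m. \<forall>x\<in>B. \<forall>y\<in>B. \<sigma> x < \<sigma> y \<longleftrightarrow> \<rho> x < \<rho> y}"
    using occurs_at_iff_same_order[OF B_def j \<rho>_def] by simp
  then have hits: "real (card {\<sigma> \<in> perms_with_inversions n m. occurs_at k \<tau> j n \<sigma>}) = g \<rho>"
    using arg_cong[OF card_perms_with_order[OF B_def j \<rho>, of m], of real_of_int]
    by (simp add: g_def f_def)
  have "P = g \<rho> / real (card (perms_with_inversions n m))"
    unfolding P_def hits[symmetric] using pos
    by (subst measure_pmf_of_set) (auto simp: Int_def card_gt_0_iff)
  then have P: "P * fact k = g \<rho> * fact k / real (card (perms_with_inversions n m))" by simp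
  have "(1 - \<epsilon>) * real (card (perms_with_inversions n m)) \<le> (1 - \<epsilon>) * (fact k * F)"
    using upper \<epsilon>(2) by (intro mult_left_mono) auto
  also have "\<dots> \<le> g \<rho> * fact k" using mult_right_mono[OF g(1)[of \<rho>], of "fact k"] by (simp add: mult_ac)
  finally show "1 - \<epsilon> \<le> P * fact k" unfolding P using pos by (simp add: le_divide_eq)
  have "(g \<rho> * fact k) * (1 - \<epsilon>) \<le> (F * fact k) * (1 - \<epsilon>)"
    using g(2)[of \<rho>] \<epsilon>(2) by (intro mult_right_mono) auto
  also have "\<dots> \<le> real (card (perms_with_inversions n m))" using lower by (simp add: mult_ac)
  finally show "P * fact k \<le> 1 / (1 - \<epsilon>)" unfolding P using pos \<epsilon>(2)
    by (simp add: field_simps)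
qed

theorem theorem1:
  fixes m k j :: "nat \<Rightarrow> nat" and \<tau> :: "nat \<Rightarrow> nat \<Rightarrow> nat"
  assumes "\<forall>\<^sub>F n in sequentially. m n > 0"
    and "\<forall>\<^sub>F n in sequentially. k n > 0"
    and "(\<lambda>n. real n / real (m n)) \<longlonglongrightarrow> 0"
    and "(\<lambda>n. real (m n) / ((real n)\<^sup>2 / (ln (real n))\<^sup>2)) \<longlonglongrightarrow> 0"
    and "(\<lambda>n. real (k n) / sqrt (real (m n) / real n)) \<longlonglongrightarrow> 0"
    and "\<forall>\<^sub>F n in sequentially. \<tau> n permutes {1..k n}"
    and "\<forall>\<^sub>F n in sequentially. 1 \<le> j n \<and> j n + k n \<le> n + 1"
  shows "(\<lambda>n. measure_pmf.prob (pmf_of_set (perms_with_inversions n (m n)))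
                {\<sigma>. occurs_at (k n) (\<tau> n) (j n) n \<sigma>})
         \<sim>[sequentially] (\<lambda>n. 1 / fact (k n))"
proof -
  define P where "P n = measure_pmf.prob (pmf_of_set (perms_with_inversions n (m n)))
                {\<sigma>. occurs_at (k n) (\<tau> n) (j n) n \<sigma>}" for n
  define \<epsilon> where "\<epsilon> n = 2 * (real (k n))\<^sup>2 * real n / real (m n)" for n
  \<comment> \<open>Squaring the growth condition on \<open>k\<close> gives exactly the error term
    \<open>\<epsilon>\<close>.\<close>
  have "(\<lambda>n. 2 * (real (k n) / sqrt (real (m n) / real n))\<^sup>2) \<longlonglongrightarrow> 2 * 0\<^sup>2"
    by (intro tendsto_intros assms)
  moreover have "2 * (real (k n) / sqrt (real (m n) / real n))\<^sup>2 = \<epsilon> n" for n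
    by (simp add: \<epsilon>_def power_divide)
  ultimately have lim: "\<epsilon> \<longlonglongrightarrow> 0" by (simp add: LIMSEQ_iff)
  have small: "\<forall>\<^sub>F n in sequentially. \<epsilon> n < 1"
    using lim by (rule order_tendstoD) simp
  \<comment> \<open>With \<open>ln n \<ge> 1\<close> this yields \<open>16 m \<le> n^2\<close>,
    which leaves room to place \<open>m\<close> below half of
    \<open>inc_degree (k n) n\<close>.\<close>
  have ratio: "\<forall>\<^sub>F n in sequentially. real (m n) / ((real n)\<^sup>2 / (ln (real n))\<^sup>2) < 1 / 16"
    using assms(4) by (rule order_tendstoD) simp
  have bounds: "\<forall>\<^sub>F n in sequentially. 1 - \<epsilon> n \<le> P n * fact (k n) \<and> P n * fact (k n) \<le> 1 / (1 - \<epsilon> n)"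
    using assms(1,6,7) small ratio eventually_ge_at_top[of 3]
  proof eventually_elim
    case (elim n)
    have "exp 1 \<le> real n" using elim(6) exp_le by linarith
    then have "1 \<le> ln (real n)" using elim(6) by (subst ln_ge_iff) auto
    then have "real (m n) \<le> real (m n) * (ln (real n))\<^sup>2" by (simp add: mult_le_cancel_left1)
    also have "\<dots> \<le> (real n)\<^sup>2 / 16" using elim(5,6) by (simp add: field_simps)
    finally have m: "16 * real (m n) \<le> real n * real n" by (simp add: power2_eq_square)
    have k: "2 * (real (k n))\<^sup>2 * real n < real (m n)"
      using elim(1,4) by (simp add: \<epsilon>_def divide_less_eq)
    \<comment> \<open>Combining \<open>2 k^2 n < m\<close> with \<open>16 m \<le> n^2\<close> makes
      \<open>k^2\<close> small against \<open>n\<close>, so that the block hardly lowers the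
      degree.\<close>
    then have "real n * (32 * (real (k n))\<^sup>2) \<le> real n * real n" using m by (simp add: mult_ac)
    then have kn: "32 * (real (k n))\<^sup>2 \<le> real n" using elim(6) by simp
    have "2 * (real (k n))\<^sup>2 * 1 \<le> 2 * (real (k n))\<^sup>2 * real n"
      using elim(6) by (intro mult_left_mono) auto
    with k have "real (2 * (k n)\<^sup>2) \<le> real (m n)" by simp
    then have km: "2 * (k n)\<^sup>2 \<le> m n" by (simp only: of_nat_le_iff)
    have "3 * real n \<le> real n * real n" using elim(6) by simp
    then have "4 * real (m n) \<le> real n * (real n - 1) - real (k n) * (real (k n) - 1)"
      using m kn by (simp add: algebra_simps power2_eq_square)
    then have "real_of_int (4 * int (m n))
        \<le> real_of_int (int n * (int n - 1) - int (k n) * (int (k n) - 1))" by simp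
    then have "4 * int (m n) \<le> int n * (int n - 1) - int (k n) * (int (k n) - 1)"
      by (simp only: of_int_le_iff)
    moreover have "k n \<le> n" using elim(3) by simp
    ultimately have "2 * int (m n) \<le> inc_degree (k n) n" using inc_degree_eq[of "k n" n] by linarith
    with elim km show ?case
      unfolding P_def by (intro conjI prob_occurs_at_bounds) (auto simp: \<epsilon>_def)
  qed
  have "(\<lambda>n. P n * fact (k n)) \<longlonglongrightarrow> 1"
  proof (rule tendsto_sandwich)
    show "\<forall>\<^sub>F n in sequentially. 1 - \<epsilon> n \<le> P n * fact (k n)"
      using bounds by eventually_elim simp
    show "\<forall>\<^sub>F n in sequentially. P n * fact (k n) \<le> 1 / (1 - \<epsilon> n)"
      using bounds by eventually_elim simp
    show "(\<lambda>n. 1 - \<epsilon> n) \<longlonglongrightarrow> 1" using tendsto_diff[OF tendsto_const lim, of 1] by simp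
    then show "(\<lambda>n. 1 / (1 - \<epsilon> n)) \<longlonglongrightarrow> 1" using tendsto_divide[OF tendsto_const, of _ 1 _ 1] by fastforce
  qed
  then show ?thesis unfolding P_def[symmetric] by (intro asymp_equivI') simp
qed

end
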